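(* Let $G=(V,E,\mathrm{lab})$ be an edge-labeled graph over a set of labels $L$. The algorithm GreedyOr (defined in the context) runs in $O(p\log^2 |L|+|V|+|E|)$ time, where $p=|\{(e,k) : e\in E,\ k\in \mathrm{lab}(e)\}|$ is the number of edge-label pairs.
   Context: An edge-labeled graph is a tuple $G=(V,E,\mathrm{lab})$, where $V$ is the set of vertices, $E$ is a set of undirected edges between distinct vertices, and $\mathrm{lab}:E\to 2^L$ maps each edge to its set of labels; $L$ is the set of all possible labels. For a label $\ell$, $E(\ell)$ is the set of edges having label $\ell$ and $V(\ell)$ is the set of vertices adjacent to $E(\ell)$. For $B\subseteq L$, the disjunctive-induced subgraph consists of the edges $e$ with $B\cap \mathrm{lab}(e)\ne\emptyset$ and the vertices adjacent to them; the density of a graph is its number of edges divided by its number of vertices. Algorithm GreedyOr (greedy search for disjunctive-induced dense subgraphs): 1. Set $n\gets0$, $m\gets0$; $n_\ell\gets|V(\ell)|$ and $m_\ell\gets|E(\ell)|$ for each label $\ell\in L$; $S_v\gets\{\ell\in L:$ there is an edge with label $\ell$ adjacent to $v\}$ and $r_v\gets0$ for each vertex $v$; $A_0\gets\emptyset$ and $i\gets0$. 2. While there are labels: pick and remove the label $k$ that yields the maximum density $\frac{m+m_k}{n+n_k}$; set $A_{i+1}\gets A_i\cup\{k\}$; for each edge $e=(u,v)$ with label $k$: decrease $m_\ell$ by one for each label $\ell$ of $e$; set $m\gets m+1$; if $r_v=0$, decrease $n_\ell$ by one for each $\ell\in S_v$ and set $n\gets n+1$; if $r_u=0$, decrease $n_\ell$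 by one for each $\ell\in S_u$ and set $n\gets n+1$; set $r_v\gets1$, $r_u\gets1$; remove the edge $e$. After this loop over edges, set $i\gets i+1$. 3. Return the set of labels $A_i$ that yields the highest density of the disjunctive-induced subgraph. The label $k$ is selected as follows. The lower-right convex hull of the points $(m_\ell,n_\ell)$ (the lower-right portion of the complete convex hull of these points, with first coordinate horizontal and second coordinate vertical) is maintained, as the values $m_\ell,n_\ell$ are updated, with the algorithm of Overmars and van Leeuwen (1981), which takes $O(\log^2|L|)$ time per update and stores the current hull in a balanced search tree. The optimal label is found by binary search over the hull in that tree: given two consecutive hull points $a=(m_a,n_a)$ and $b=(m_b,n_b)$, ordered by increasing first coordinate, one tests whether $m\le n\,\frac{m_b-m_a}{n_b-n_a}+\frac{m_bn_a-m_an_b}{n_b-n_a}$; if true, the search continues at $b$ or to the right of $b$, and otherwise to the left of $b$.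
   Formalization: Assumes that V is nonempty and that every label in L occurs on some edge; otherwise GreedyOr's |L| rounds can exceed the bound (e.g. one edge with one label and |L| large) and the first density may be 0/0. *)

theory Defs
  imports "HOL-Analysis.Analysis" "HOL-Library.Tree" "HOL-Library.Monad_Syntax"
begin

section \<open>Edge-labeled graphs\<close>

locale edge_labeled_graph =
  fixes V :: "'v set" and E :: "'v set set" and lab :: "'v set \<Rightarrow> 'l set" and L :: "'l set"
  assumes finite_vertices: "finite V"
    and finite_labels: "finite L"
    and edges: "E \<subseteq> {{u, v} | u v. u \<in> V \<and> v \<in> V \<and> u \<noteq> v}"
    and labels: "\<And>e. e \<in> E \<Longrightarrow> lab e \<subseteq> L"

text \<open>
  The input of the algorithm: a list of the vertices, a list of the labels, and a list of the edges,
  each edge given by its two end points and a list of its labels. The order within the lists and the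
  orientation of the edges are arbitrary.
\<close>

definition encodes ::
  "'v list \<Rightarrow> 'l list \<Rightarrow> ('v \<times> 'v \<times> 'l list) list \<Rightarrow>
   'v set \<Rightarrow> 'v set set \<Rightarrow> ('v set \<Rightarrow> 'l set) \<Rightarrow> 'l set \<Rightarrow> bool" where
  "encodes vs ls es V E lab L \<longleftrightarrow>
     distinct vs \<and> set vs = V \<and>
     distinct ls \<and> set ls = L \<and>
     distinct (map (\<lambda>(u, v, xs). {u, v}) es) \<and> (\<lambda>(u, v, xs). {u, v}) ` set es = E \<and>
     (\<forall>(u, v, xs) \<in> set es. distinct xs \<and> set xs = lab {u, v})"


section \<open>Cost model\<close>

text \<open>
  A computation consists of its result and the number of elementary operations it performs
  (uniform-cost random access machine). Vertices, labels and edge numbers serve as array indices,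
  and arrays are modelled as functions that are read and written one cell at a time. The only source
  of cost, besides the operations of the hull structure below, is \<open>step x\<close>; every \<open>x\<close> to
  which it is applied in a program is obtained by a bounded number of reads and writes of variables
  and array cells, list constructor and selector operations, and arithmetic operations and
  comparisons of numbers.
\<close>

datatype 'a timed = Timed (val: 'a) (time: nat)

definition bind_timed :: "'a timed \<Rightarrow> ('a \<Rightarrow> 'b timed) \<Rightarrow> 'b timed" where
  "bind_timed c f = Timed (val (f (val c))) (time c + time (f (val c)))"

adhoc_overloading Monad_Syntax.bind \<rightleftharpoons> bind_timed

definition step :: "'a \<Rightarrow> 'a timed" where
  "step x = Timed x 1"

fun foreach :: "'a list \<Rightarrow> ('a \<Rightarrow> 's \<Rightarrow> 's timed) \<Rightarrow> 's \<Rightarrow> 's timed" where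
  "foreach [] f s = step s"
| "foreach (x # xs) f s = do { s \<leftarrow> step s; s \<leftarrow> f x s; foreach xs f s }"


section \<open>Maintaining the lower-right hull\<close>

text \<open>
  The vertices of the lower-right portion of the convex hull: the extreme points that have no other
  point of the hull in the closed quadrant to their lower right.
\<close>

definition lower_right_hull :: "(real \<times> real) set \<Rightarrow> (real \<times> real) set" where
  "lower_right_hull P =
     {x. x extreme_point_of (convex hull P) \<and>
         (\<forall>y \<in> convex hull P. fst x \<le> fst y \<and> snd y \<le> snd x \<longrightarrow> y = x)}"

text \<open>
  A triple \<open>(i, j, l)\<close> is the point \<open>(i, j)\<close> belonging to the label \<open>l\<close>. Several labels may share
  a point.
\<close>

type_synonym 'l entry = "nat \<times> nat \<times> 'l"

fun point :: "'l entry \<Rightarrow> real \<times> real" where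
  "point (i, j, l) = (real i, real j)"

record ('l, 'h) hull_structure =
  hull_empty :: "'h"
  hull_insert :: "'l entry \<Rightarrow> 'h \<Rightarrow> 'h timed"
  hull_delete :: "'l entry \<Rightarrow> 'h \<Rightarrow> 'h timed"
  hull_tree :: "'h \<Rightarrow> 'l entry tree"

text \<open>
  The guarantees of Overmars and van Leeuwen (1981): the structure maintains a finite set of entries
  under insertions and deletions in \<open>O(log\<^sup>2 n)\<close> time each, where \<open>n\<close> is the number of entries, and
  gives access to a balanced search tree with the vertices of the current lower-right hull in order
  of increasing first coordinate, one entry for each vertex. The offset 2 keeps the time bounds
  positive for \<open>n \<le> 1\<close>.
\<close>

definition dynamic_hull :: "('l, 'h) hull_structure \<Rightarrow> bool" where
  "dynamic_hull D \<longleftrightarrow>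
     (\<exists>(invar :: 'h \<Rightarrow> bool) (entries :: 'h \<Rightarrow> 'l entry set) (c :: real).
        invar (hull_empty D) \<and> entries (hull_empty D) = {} \<and>
        (\<forall>h. invar h \<longrightarrow>
           finite (entries h) \<and>
           set_tree (hull_tree D h) \<subseteq> entries h \<and>
           point ` set_tree (hull_tree D h) = lower_right_hull (point ` entries h) \<and>
           sorted_wrt (\<lambda>a b. fst a < fst b) (inorder (hull_tree D h)) \<and>
           real (height (hull_tree D h)) \<le> c * log 2 (real (size1 (hull_tree D h))) \<and>
           (\<forall>x. invar (val (hull_insert D x h)) \<and>
                entries (val (hull_insert D x h)) = insert x (entries h) \<and>
                real (time (hull_insert D x h)) \<le> c * (log 2 (real (card (entries h) + 2)))\<^sup>2 \<and>
                invar (val (hull_delete D x h)) \<and>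
                entries (val (hull_delete D x h)) = entries h - {x} \<and>
                real (time (hull_delete D x h)) \<le> c * (log 2 (real (card (entries h) + 2)))\<^sup>2)))"


section \<open>Selecting a label of maximum density\<close>

text \<open>
  For consecutive hull points \<open>a\<close>, \<open>b\<close>: is the density obtained by adding \<open>b\<close> at least the one
  obtained by adding \<open>a\<close>?
\<close>

fun continue_right :: "nat \<Rightarrow> nat \<Rightarrow> 'l entry \<Rightarrow> 'l entry \<Rightarrow> bool" where
  "continue_right m n (ma, na, _) (mb, nb, _) \<longleftrightarrow>
     (let m = of_nat m; n = of_nat n; ma = of_nat ma; na = of_nat na; mb = of_nat mb; nb = of_nat nb
      in (m :: rat) \<le> n * ((mb - ma) / (nb - na)) + (mb * na - ma * nb) / (nb - na))"

fun rightmost :: "'a tree \<Rightarrow> 'a option \<Rightarrow> 'a option timed" where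
  "rightmost Leaf d = step d"
| "rightmost (Node l x r) d = do { d \<leftarrow> step (Some x); rightmost r d }"

text \<open>
  Binary search in a subtree of the hull. The argument \<open>a\<close> is the hull point immediately preceding
  those of the subtree (\<open>None\<close> if there is no such point); it is the result unless the search
  continues right at some point of the subtree.
\<close>

fun search :: "nat \<Rightarrow> nat \<Rightarrow> 'l entry tree \<Rightarrow> 'l entry option \<Rightarrow> 'l entry option timed" where
  "search m n Leaf a = step a"
| "search m n (Node l b r) a = do {
     p \<leftarrow> rightmost l a;
     right \<leftarrow> step (case p of None \<Rightarrow> True | Some p' \<Rightarrow> continue_right m n p' b);
     if right then search m n r (Some b) else search m n l a
   }"


section \<open>The algorithm GreedyOr\<close>

text \<open>An edge is referred to by its number, its end points and its labels.\<close>

type_synonym ('v, 'l) edge = "nat \<times> 'v \<times> 'v \<times> 'l list"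

text \<open>
  \<open>m_cur\<close>, \<open>n_cur\<close>, \<open>m_of\<close>, \<open>n_of\<close>, \<open>S_of\<close> and \<open>r_of\<close> are the variables
  $m$, $n$, $m_l$, $n_l$, $S_v$, $r_v$. The list \<open>A_cur\<close> is the current set $A_i$ and \<open>history\<close> holds
  all sets $A_0, \dots, A_i$ (as linked lists with shared tails), each with the numbers of edges and
  vertices of its disjunctive-induced subgraph. \<open>edges_of l\<close> lists the edges that
  had label \<open>l\<close> in the input graph, and \<open>removed\<close> marks the edges that have been removed since.
  \<open>seen v\<close> is the last label recorded for \<open>v\<close> during the initialisation.
\<close>

record ('v, 'l, 'h) state =
  m_cur :: nat
  n_cur :: nat
  m_of :: "'l \<Rightarrow> nat"
  n_of :: "'l \<Rightarrow> nat"
  S_of :: "'v \<Rightarrow> 'l list"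
  r_of :: "'v \<Rightarrow> nat"
  A_cur :: "'l list"
  history :: "('l list \<times> nat \<times> nat) list"
  hull_cur :: "'h"
  available :: "'l \<Rightarrow> bool"
  labels_left :: nat
  edges_of :: "'l \<Rightarrow> ('v, 'l) edge list"
  removed :: "nat \<Rightarrow> bool"
  edge_count :: nat
  seen :: "'v \<Rightarrow> 'l option"

definition start :: "('l, 'h) hull_structure \<Rightarrow> ('v, 'l, 'h) state" where
  "start D = \<lparr>
     m_cur = 0, n_cur = 0, m_of = \<lambda>_. undefined, n_of = \<lambda>_. undefined,
     S_of = \<lambda>_. undefined, r_of = \<lambda>_. undefined,
     A_cur = [], history = [([], 0, 0)],
     hull_cur = hull_empty D, available = \<lambda>_. undefined, labels_left = 0,
     edges_of = \<lambda>_. undefined, removed = \<lambda>_. undefined, edge_count = 0, seen = \<lambda>_. undefined\<rparr>"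

definition init_vertex :: "'v \<Rightarrow> ('v, 'l, 'h) state \<Rightarrow> ('v, 'l, 'h) state timed" where
  "init_vertex v s =
     step (s\<lparr>S_of := (S_of s)(v := []), r_of := (r_of s)(v := 0), seen := (seen s)(v := None)\<rparr>)"

definition init_label :: "'l \<Rightarrow> ('v, 'l, 'h) state \<Rightarrow> ('v, 'l, 'h) state timed" where
  "init_label l s =
     step (s\<lparr>m_of := (m_of s)(l := 0), n_of := (n_of s)(l := 0), edges_of := (edges_of s)(l := []),
             available := (available s)(l := True), labels_left := labels_left s + 1\<rparr>)"

definition init_edge ::
  "'v \<times> 'v \<times> 'l list \<Rightarrow> ('v, 'l, 'h) state \<Rightarrow> ('v, 'l, 'h) state timed" where
  "init_edge = (\<lambda>(u, v, xs) s. do {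
     let e = (edge_count s, u, v, xs);
     s \<leftarrow> step (s\<lparr>removed := (removed s)(edge_count s := False), edge_count := edge_count s + 1\<rparr>);
     foreach xs (\<lambda>l s.
       step (s\<lparr>m_of := (m_of s)(l := m_of s l + 1),
               edges_of := (edges_of s)(l := e # edges_of s l)\<rparr>)) s
   })"

definition record_label :: "'l \<Rightarrow> 'v \<Rightarrow> ('v, 'l, 'h) state \<Rightarrow> ('v, 'l, 'h) state timed" where
  "record_label l v s =
     (if seen s v = Some l then step s
      else step (s\<lparr>seen := (seen s)(v := Some l), S_of := (S_of s)(v := l # S_of s v),
                   n_of := (n_of s)(l := n_of s l + 1)\<rparr>))"

definition init_point ::
  "('l, 'h) hull_structure \<Rightarrow> 'l \<Rightarrow> ('v, 'l, 'h) state \<Rightarrow> ('v, 'l, 'h) state timed" where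
  "init_point D l s = do {
     s \<leftarrow> foreach (edges_of s l)
       (\<lambda>(_, u, v, _) s. do { s \<leftarrow> record_label l u s; record_label l v s }) s;
     h \<leftarrow> hull_insert D (m_of s l, n_of s l, l) (hull_cur s);
     step (s\<lparr>hull_cur := h\<rparr>)
   }"

definition move_point ::
  "('l, 'h) hull_structure \<Rightarrow> 'l \<Rightarrow> nat \<Rightarrow> nat \<Rightarrow> ('v, 'l, 'h) state \<Rightarrow> ('v, 'l, 'h) state timed" where
  "move_point D l i j s = do {
     h \<leftarrow> (if available s l
          then do { h \<leftarrow> hull_delete D (m_of s l, n_of s l, l) (hull_cur s); hull_insert D (i, j, l) h }
          else step (hull_cur s));
     step (s\<lparr>hull_cur := h, m_of := (m_of s)(l := i), n_of := (n_of s)(l := j)\<rparr>)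
   }"

definition reach_vertex ::
  "('l, 'h) hull_structure \<Rightarrow> 'v \<Rightarrow> ('v, 'l, 'h) state \<Rightarrow> ('v, 'l, 'h) state timed" where
  "reach_vertex D v s =
     (if r_of s v = 0
      then do {
        s \<leftarrow> foreach (S_of s v) (\<lambda>l s. move_point D l (m_of s l) (n_of s l - 1) s) s;
        step (s\<lparr>n_cur := n_cur s + 1, r_of := (r_of s)(v := 1)\<rparr>)
      }
      else step s)"

definition process_edge ::
  "('l, 'h) hull_structure \<Rightarrow> ('v, 'l) edge \<Rightarrow> ('v, 'l, 'h) state \<Rightarrow> ('v, 'l, 'h) state timed" where
  "process_edge D = (\<lambda>(e, u, v, xs) s.
     if removed s e then step s
     else do {
       s \<leftarrow> foreach xs (\<lambda>l s. move_point D l (m_of s l - 1) (n_of s l) s) s;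
       s \<leftarrow> step (s\<lparr>m_cur := m_cur s + 1\<rparr>);
       s \<leftarrow> reach_vertex D v s;
       s \<leftarrow> reach_vertex D u s;
       step (s\<lparr>removed := (removed s)(e := True)\<rparr>)
     })"

text \<open>The hull is empty only if no label is left, so the case \<open>None\<close> does not occur.\<close>

definition select_label ::
  "('l, 'h) hull_structure \<Rightarrow> ('v, 'l, 'h) state \<Rightarrow> ('v, 'l, 'h) state timed" where
  "select_label D s = do {
     t \<leftarrow> step (hull_tree D (hull_cur s));
     found \<leftarrow> search (m_cur s) (n_cur s) t None;
     (case found of
        None \<Rightarrow> step s
      | Some (i, j, k) \<Rightarrow> do {
          h \<leftarrow> hull_delete D (i, j, k) (hull_cur s);
          s \<leftarrow> step (s\<lparr>hull_cur := h, available := (available s)(k := False), A_cur := k # A_cur s\<rparr>);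
          s \<leftarrow> foreach (edges_of s k) (process_edge D) s;
          step (s\<lparr>history := (A_cur s, m_cur s, n_cur s) # history s\<rparr>)
        })
   }"

fun while_labels ::
  "('l, 'h) hull_structure \<Rightarrow> nat \<Rightarrow> ('v, 'l, 'h) state \<Rightarrow> ('v, 'l, 'h) state timed" where
  "while_labels D 0 s = step s"
| "while_labels D (Suc i) s = do { s \<leftarrow> select_label D s; while_labels D i s }"

text \<open>The empty graph gets density 0, by \<open>x / 0 = 0\<close>.\<close>

fun density :: "'l list \<times> nat \<times> nat \<Rightarrow> rat" where
  "density (_, i, j) = of_nat i / of_nat j"

definition greedy_or ::
  "('l, 'h) hull_structure \<Rightarrow> 'v list \<Rightarrow> 'l list \<Rightarrow> ('v \<times> 'v \<times> 'l list) list \<Rightarrow> 'l list timed" where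
  "greedy_or D vs ls es = do {
     s \<leftarrow> step (start D :: ('v, 'l, 'h) state);
     s \<leftarrow> foreach vs init_vertex s;
     s \<leftarrow> foreach ls init_label s;
     s \<leftarrow> foreach es init_edge s;
     s \<leftarrow> foreach ls (init_point D) s;
     s \<leftarrow> while_labels D (labels_left s) s;
     best \<leftarrow> foreach (history s)
       (\<lambda>c best. if density best < density c then step c else step best) ([], 0, 0);
     step (fst best)
   }"

end

theory Submission
  imports Defs
begin

text \<open>
  Each edge is removed at most once and then moves the points of its own labels; each vertex is
  reached at most once and then moves the points of the labels in \<open>S_of\<close>, and these lists have
  total length at most \<open>2 * p\<close> because every edge-label pair records its label at two end points.
  Each label is selected at most once, since the hull contains only available labels, so the edge
  lists are traversed at most once. Hence \<open>O(p)\<close> points are moved. A potential function makes this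
  accounting precise. Locating the predecessor of a hull point takes a descent of its own, so the
  binary search costs the square of the tree height, which is still within the price \<open>H\<close> of a hull
  update. Finally \<open>|L| \<le> p\<close> because every label occurs on an edge, and for \<open>|L| \<le> 1\<close>, where the
  logarithm vanishes, \<open>p \<le> |E|\<close>.
\<close>

section \<open>Amortized running time\<close>

lemma val_bind [simp]: "val (bind_timed c f) = val (f (val c))"
  and time_bind [simp]: "time (bind_timed c f) = time c + time (f (val c))"
  by (simp_all add: bind_timed_def)

lemma val_step [simp]: "val (step x) = x"
  and time_step [simp]: "time (step x) = 1"
  by (simp_all add: step_def)

text \<open>A Hoare triple with potentials. The potential before the run enters through the budget
  \<open>b\<close>, which must cover the running time and the potential that is left at the
  end.\<close>

definition amortized :: "'a timed \<Rightarrow> ('a \<Rightarrow> bool) \<Rightarrow> ('a \<Rightarrow> real) \<Rightarrow> real \<Rightarrow> bool" where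
  "amortized c Q \<Phi> b \<longleftrightarrow> Q (val c) \<and> real (time c) + \<Phi> (val c) \<le> b"

lemma amortized_step: "Q x \<Longrightarrow> 1 + \<Phi> x \<le> b \<Longrightarrow> amortized (step x) Q \<Phi> b"
  by (simp add: amortized_def)

lemma amortized_mono:
  "amortized c Q \<Phi> b \<Longrightarrow> (\<And>x. Q x \<Longrightarrow> Q' x) \<Longrightarrow> b \<le> b' \<Longrightarrow> amortized c Q' \<Phi> b'"
  by (auto simp: amortized_def)

text \<open>\<open>d\<close> is the net charge of the continuation; it is negative when more
  potential is released than spent. \<open>\<Psi>\<close> and \<open>\<Phi>\<close> may differ, so
  the potential can change between phases.\<close>

lemma amortized_bind:
  assumes "amortized c P \<Psi> a"
    and "\<And>x. P x \<Longrightarrow> amortized (f x) Q \<Phi> (\<Psi> x + d)"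
    and "a + d \<le> b"
  shows "amortized (bind_timed c f) Q \<Phi> b"
  using assms(1) assms(2)[of "val c"] assms(3) by (simp add: amortized_def)

text \<open>The invariant depends on the elements still to come and can thus describe those already
  visited. The additional 1 per element and the 1 at the end are the steps of \<open>foreach\<close>
  itself.\<close>

lemma amortized_foreach:
  assumes "\<And>x ys s. I (x # ys) s \<Longrightarrow> amortized (f x s) (I ys) \<Phi> (\<Phi> s + w x)"
    and "I xs s" and "\<Phi> s + (\<Sum>x\<leftarrow>xs. w x + 1) + 1 \<le> b"
  shows "amortized (foreach xs f s) (I []) \<Phi> b"
  using assms(2,3)
proof (induction xs arbitrary: s b)
  case Nil
  then show ?case by (auto intro: amortized_step)
next
  case (Cons x xs)
  have f: "amortized (f x s) (I xs) \<Phi> (\<Phi> s + w x)"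
    using Cons.prems(1) by (rule assms(1))
  have "amortized (foreach xs f (val (f x s))) (I [])
      \<Phi> (\<Phi> (val (f x s)) + (\<Sum>x\<leftarrow>xs. w x + 1) + 1)"
    using f by (intro Cons.IH) (auto simp: amortized_def)
  with f Cons.prems(2) show ?case
    by (simp add: amortized_def)
qed

lemma amortized_foreach_invariant:
  assumes "\<And>x s. x \<in> set xs \<Longrightarrow> I s \<Longrightarrow> amortized (f x s) I \<Phi> (\<Phi> s + w x)"
    and "I s" and "\<Phi> s + (\<Sum>x\<leftarrow>xs. w x + 1) + 1 \<le> b"
  shows "amortized (foreach xs f s) I \<Phi> b"
proof -
  have "amortized (foreach xs f s) ((\<lambda>ys s. set ys \<subseteq> set xs \<and> I s) []) \<Phi> b"
    using assms(2,3)
    by (intro amortized_foreach[where w = w])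
      (auto intro!: amortized_mono[OF assms(1)])
  then show ?thesis by simp
qed

lemma sum_increment_one:
  fixes f g :: "'a \<Rightarrow> real"
  assumes "finite A" "x \<in> A" "\<And>y. y \<noteq> x \<Longrightarrow> f y = g y"
  shows "sum f A = sum g A + (f x - g x)"
proof -
  have "sum f (A - {x}) = sum g (A - {x})" using assms(3) by (intro sum.cong) auto
  then show ?thesis using assms(1,2) by (simp add: sum.remove)
qed


section \<open>Searching the hull\<close>

lemma time_rightmost: "time (rightmost t d) \<le> height t + 1"
  by (induction t d rule: rightmost.induct) (auto intro: le_SucI max.coboundedI2 order_trans)

text \<open>Each level of the descent runs \<open>rightmost\<close> once in the left subtree, so
  linear costs add up to a square: (h + 1) + 1 + (h + 1)^2 \<le> (h + 2)^2.\<close>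

lemma time_search: "time (search m n t a) \<le> (height t + 1)\<^sup>2"
proof (induction m n t a rule: search.induct)
  case (2 m n l b r a)
  define h where "h = max (height l) (height r)"
  define q where "q = (case val (rightmost l a) of None \<Rightarrow> True | Some p' \<Rightarrow> continue_right m n p' b)"
  have mono: "(height l + 1)\<^sup>2 \<le> (h + 1)\<^sup>2" "(height r + 1)\<^sup>2 \<le> (h + 1)\<^sup>2"
    by (auto simp: h_def intro!: power_mono)
  have "time (if q then search m n r (Some b) else search m n l a) \<le> (h + 1)\<^sup>2"
  proof (cases q)
    case True
    then show ?thesis using 2(1)[of q] mono by (auto intro: order_trans)
  next
    case False
    then show ?thesis using 2(2)[of q] mono by (auto intro: order_trans)
  qed
  moreover have "time (rightmost l a) \<le> h + 1"
    using time_rightmost[of l a] by (auto simp: h_def)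
  moreover have "height (Node l b r) = Suc h" by (simp add: h_def)
  moreover have "time (search m n (Node l b r) a) = time (rightmost l a) + 1 +
      time (if q then search m n r (Some b) else search m n l a)"
    by (simp add: q_def)
  ultimately show ?case
    by (simp add: power2_eq_square del: search.simps)
qed simp

text \<open>A search started with \<open>None\<close> can only return an entry of the tree; this is
  what makes every selected label an available one.\<close>

lemma search_result:
  "val (search m n t a) = Some x \<Longrightarrow> x \<in> set_tree t \<or> a = Some x"
  by (induction m n t a rule: search.induct) (auto split: if_splits)

text \<open>One price \<open>H\<close> for insertion, deletion and search, valid while at most
  \<open>N\<close> entries are stored, keeps logarithms out of the accounting.\<close>

locale hull_cost =
  fixes D :: "('l, 'h) hull_structure"
    and invar :: "'h \<Rightarrow> bool"
    and entries :: "'h \<Rightarrow> 'l entry set"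
    and N :: nat
    and H :: real
  assumes invar_empty: "invar (hull_empty D)" "entries (hull_empty D) = {}"
    and invar_insert: "invar h \<Longrightarrow> invar (val (hull_insert D x h))"
    and invar_delete: "invar h \<Longrightarrow> invar (val (hull_delete D x h))"
    and entries_insert: "invar h \<Longrightarrow> entries (val (hull_insert D x h)) = insert x (entries h)"
    and entries_delete: "invar h \<Longrightarrow> entries (val (hull_delete D x h)) = entries h - {x}"
    and tree_entries: "invar h \<Longrightarrow> set_tree (hull_tree D h) \<subseteq> entries h"
    and cost_insert: "invar h \<Longrightarrow> card (entries h) \<le> N \<Longrightarrow> real (time (hull_insert D x h)) \<le> H"
    and cost_delete: "invar h \<Longrightarrow> card (entries h) \<le> N \<Longrightarrow> real (time (hull_delete D x h)) \<le> H"
    and cost_search: "invar h \<Longrightarrow> card (entries h) \<le> N \<Longrightarrow>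
      real (time (search m n (hull_tree D h) None)) \<le> H"
    and cost_ge_1: "1 \<le> H"

text \<open>Strictly increasing first coordinates exclude repeated nodes. This turns the height
  bound, given by the tree size, into one by the number of entries.\<close>

lemma size_tree_le_card:
  fixes t :: "'l entry tree"
  assumes "sorted_wrt (\<lambda>a b. fst a < fst b) (inorder t)" "set_tree t \<subseteq> A" "finite A"
  shows "size t \<le> card A"
proof -
  have "distinct xs" if "sorted_wrt (\<lambda>a b. fst a < fst b) xs" for xs :: "'l entry list"
    using that by (induction xs) auto
  then have "distinct (inorder t)" using assms(1) .
  then have "size t = card (set_tree t)"
    using distinct_card[of "inorder t"] by (simp add: set_inorder length_inorder)
  then show ?thesis using assms(2,3) by (simp add: card_mono)
qed

text \<open>\<open>c\<close> is fixed before \<open>N\<close>, so the final constant does not depend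
  on the graph.\<close>

lemma dynamic_hull_cost:
  fixes D :: "('l, 'h) hull_structure"
  assumes "dynamic_hull D"
  obtains invar entries c
  where "0 \<le> c" "\<And>N. hull_cost D invar entries N (c * (log 2 (real (N + 2)))\<^sup>2)"
proof -
  obtain invar :: "'h \<Rightarrow> bool" and entries :: "'h \<Rightarrow> 'l entry set" and c\<^sub>0 :: real where
    empty: "invar (hull_empty D)" "entries (hull_empty D) = {}" and
    hull: "\<And>h. invar h \<Longrightarrow>
           finite (entries h) \<and>
           set_tree (hull_tree D h) \<subseteq> entries h \<and>
           sorted_wrt (\<lambda>a b. fst a < fst b) (inorder (hull_tree D h)) \<and>
           real (height (hull_tree D h)) \<le> c\<^sub>0 * log 2 (real (size1 (hull_tree D h))) \<and>
           (\<forall>x. invar (val (hull_insert D x h)) \<and>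
                entries (val (hull_insert D x h)) = insert x (entries h) \<and>
                real (time (hull_insert D x h)) \<le> c\<^sub>0 * (log 2 (real (card (entries h) + 2)))\<^sup>2 \<and>
                invar (val (hull_delete D x h)) \<and>
                entries (val (hull_delete D x h)) = entries h - {x} \<and>
                real (time (hull_delete D x h)) \<le> c\<^sub>0 * (log 2 (real (card (entries h) + 2)))\<^sup>2)"
    using assms unfolding dynamic_hull_def 
    by - (elim exE conjE, rule that, assumption, assumption, drule spec, drule (1) mp,
        elim conjE, intro conjI, assumption+)
  \<comment> \<open>The maximum with 1 guards against a negative \<open>c\<^sub>0\<close> and lets
    \<open>c * g\<close> absorb the 1 in \<open>height t + 1\<close>. Squaring
    \<open>2 * (c * g)\<close> then gives the factor \<open>4 * c\<^sup>2\<close>, which also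
    dominates \<open>c\<close>, the factor for updates.\<close>
  define c where "c = max 1 c\<^sub>0"
  have c: "1 \<le> c" "c\<^sub>0 \<le> c" by (auto simp: c_def)
  have "c * 1 \<le> c * c" using c by (intro mult_left_mono) auto
  then have c2: "c \<le> 4 * c\<^sup>2" using c by (simp add: power2_eq_square)
  have "hull_cost D invar entries N (4 * c\<^sup>2 * (log 2 (real (N + 2)))\<^sup>2)" for N
  proof -
    define g where "g = log 2 (real (N + 2))"
    have g: "1 \<le> g" by (simp add: g_def)
    then have g2: "1 \<le> g\<^sup>2" by simp
    have bound: "real t \<le> 4 * c\<^sup>2 * g\<^sup>2"
      if "real t \<le> c\<^sub>0 * (log 2 (real (k + 2)))\<^sup>2" "k \<le> N" for t k :: nat
    proof -
      have "(log 2 (real (k + 2)))\<^sup>2 \<le> g\<^sup>2"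
        using that(2) by (intro power_mono) (auto simp: g_def)
      then have "c\<^sub>0 * (log 2 (real (k + 2)))\<^sup>2 \<le> (4 * c\<^sup>2) * g\<^sup>2"
        using c c2 by (intro mult_mono) auto
      with that(1) show ?thesis by linarith
    qed
    have update: "real (time (hull_insert D x h)) \<le> 4 * c\<^sup>2 * g\<^sup>2"
      "real (time (hull_delete D x h)) \<le> 4 * c\<^sup>2 * g\<^sup>2"
      if "invar h" "card (entries h) \<le> N" for h x
      using hull[OF that(1)] by (blast intro: bound[OF _ that(2)])+
    have search: "real (time (search m n (hull_tree D h) None)) \<le> 4 * c\<^sup>2 * g\<^sup>2"
      if h: "invar h" "card (entries h) \<le> N" for h m n
    proof -
      define t where "t = hull_tree D h"
      have "size t \<le> N"
        using size_tree_le_card[of t "entries h"] hull[OF h(1)] h(2) by (auto simp: t_def)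
      then have "log 2 (real (size1 t)) \<le> g"
        by (simp add: g_def size1_size)
      moreover have "0 \<le> log 2 (real (size1 t))"
        by (simp add: size1_size)
      ultimately have "c\<^sub>0 * log 2 (real (size1 t)) \<le> c * g"
        using c by (intro mult_mono) auto
      with hull[OF h(1)] have "real (height t) \<le> c * g" by (auto simp: t_def)
      moreover have "1 * 1 \<le> c * g" using c g by (intro mult_mono) auto
      ultimately have "real (height t + 1) \<le> 2 * (c * g)" by simp
      then have "(real (height t + 1))\<^sup>2 \<le> (2 * (c * g))\<^sup>2"
        by (intro power_mono) auto
      moreover have "real (time (search m n t None)) \<le> (real (height t + 1))\<^sup>2"
        using time_search[of m n t None] by (metis of_nat_le_iff of_nat_power)
      ultimately show ?thesis by (simp add: t_def power_mult_distrib)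
    qed
    have "1 * 1 \<le> (4 * c\<^sup>2) * g\<^sup>2"
      using c c2 g2 by (intro mult_mono) auto
    with hull search update empty show ?thesis
      unfolding g_def[symmetric] by unfold_locales auto
  qed
  then show thesis by (intro that[of "4 * c\<^sup>2" invar entries]) auto
qed


section \<open>A run of GreedyOr\<close>

text \<open>The number p of edge-label pairs, read off the encoding; see
  \<open>encodes_card_pairs\<close>.\<close>

definition label_pairs :: "('v \<times> 'v \<times> 'l list) list \<Rightarrow> nat" where
  "label_pairs es = (\<Sum>(u, v, xs)\<leftarrow>es. length xs)"

locale greedy_run = hull_cost D invar entries "length ls" H
  for D :: "('l, 'h) hull_structure" and invar entries H and ls :: "'l list" +
  fixes vs :: "'v list" and es :: "('v \<times> 'v \<times> 'l list) list"
  assumes distinct_labels: "distinct ls"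
    and distinct_vertices: "distinct vs"
    and wf_edges: "(u, v, xs) \<in> set es \<Longrightarrow> u \<in> set vs \<and> v \<in> set vs \<and> set xs \<subseteq> set ls"
begin

text \<open>The number stored with an edge is its position in \<open>es\<close>, so the array
  \<open>removed\<close> can index the edge sum of \<open>potential\<close>.\<close>

definition edges_ok :: "('v, 'l, 'h) state \<Rightarrow> bool" where
  "edges_ok s \<longleftrightarrow>
    (\<forall>l \<in> set ls. \<forall>(i, u, v, xs) \<in> set (edges_of s l). i < length es \<and> es ! i = (u, v, xs))"

text \<open>As the label determines the coordinates, there is at most one entry per label, and a
  deletion at the current coordinates removes it. Restricting entries to available labels ensures
  that a selected label still holds its potential.\<close>

definition hull_ok :: "('v, 'l, 'h) state \<Rightarrow> bool" where
  "hull_ok s \<longleftrightarrow> invar (hull_cur s) \<and>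
    (\<forall>(i, j, l) \<in> entries (hull_cur s).
      l \<in> set ls \<and> available s l \<and> i = m_of s l \<and> j = n_of s l)"

definition wf_state :: "('v, 'l, 'h) state \<Rightarrow> bool" where
  "wf_state s \<longleftrightarrow> hull_ok s \<and> edges_ok s \<and> (\<forall>v \<in> set vs. set (S_of s v) \<subseteq> set ls)"

text \<open>
  Every edge not yet removed, every vertex not yet reached and every label still available
  holds the time that it will consume once; each history entry holds the time for inspecting it
  in the end.
\<close>

definition potential :: "('v, 'l, 'h) state \<Rightarrow> real" where
  "potential s =
     (\<Sum>i \<in> {i. i < length es \<and> \<not> removed s i}. 4 * H * length (snd (snd (es ! i))) + 4) +
     (\<Sum>v \<in> {v \<in> set vs. r_of s v = 0}. 4 * H * length (S_of s v) + 1) +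
     (\<Sum>l \<in> {l \<in> set ls. available s l}. 2 * length (edges_of s l)) +
     2 * length (history s)"

lemma card_entries_le:
  assumes "\<forall>(i, j, l) \<in> A. l \<in> set ls \<and> i = f l \<and> j = g l"
  shows "card A \<le> length ls"
proof -
  have "card A \<le> card ((\<lambda>l. (f l, g l, l)) ` set ls)"
    using assms by (intro card_mono) auto
  also have "\<dots> \<le> card (set ls)" by (rule card_image_le) auto
  also have "\<dots> \<le> length ls" by (rule card_length)
  finally show ?thesis .
qed

lemma hull_ok_card: "hull_ok s \<Longrightarrow> card (entries (hull_cur s)) \<le> length ls"
  by (rule card_entries_le[of _ "m_of s" "n_of s"]) (auto simp: hull_ok_def)


subsection \<open>The main loop\<close>

text \<open>None of the three changed fields occurs in \<open>potential\<close>, so moving a point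
  preserves it.\<close>

lemma move_point_frame:
  obtains h where "val (move_point D l i j s) =
    s\<lparr>hull_cur := h, m_of := (m_of s)(l := i), n_of := (n_of s)(l := j)\<rparr>"
  by (auto simp: move_point_def)

lemma move_point_hull_ok:
  assumes "hull_ok s" "l \<in> set ls"
  shows "hull_ok (val (move_point D l i j s))"
proof -
  have inv: "invar (hull_cur s)" using assms by (simp add: hull_ok_def)
  show ?thesis
    using assms
    by (auto simp: hull_ok_def move_point_def invar_insert invar_delete entries_insert
        entries_delete inv)
qed

lemma move_point_time:
  assumes "hull_ok s"
  shows "real (time (move_point D l i j s)) \<le> 3 * H"
proof -
  have inv: "invar (hull_cur s)" using assms by (simp add: hull_ok_def)
  define h where "h = val (hull_delete D (m_of s l, n_of s l, l) (hull_cur s))"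
  have h: "invar h" "card (entries h) \<le> length ls"
    using inv hull_ok_card[OF assms]
    by (auto simp: h_def invar_delete entries_delete intro: order_trans[OF card_Diff1_le])
  show ?thesis
    using cost_delete[OF inv hull_ok_card[OF assms], of "(m_of s l, n_of s l, l)"]
      cost_insert[OF h, of "(i, j, l)"] cost_ge_1
    by (auto simp: move_point_def h_def)
qed

text \<open>\<open>P\<close> carries facts about \<open>removed\<close> and \<open>r_of\<close>
  through the loop, which changes neither. The charge \<open>4 * H\<close> per label is
  \<open>3 * H\<close> for the move and 1 \<le> \<open>H\<close> for the iteration.\<close>

lemma amortized_move_points:
  assumes "wf_state s" "P (removed s) (r_of s)" "set xs \<subseteq> set ls"
    and b: "potential s + 4 * H * length xs + 1 \<le> b"
  shows "amortized (foreach xs (\<lambda>l s. move_point D l (i l s) (j l s) s) s)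
    (\<lambda>s. wf_state s \<and> P (removed s) (r_of s)) potential b"
proof (rule amortized_foreach_invariant[where w = "\<lambda>_. 3 * H"])
  fix l and t :: "('v, 'l, 'h) state"
  assume l: "l \<in> set xs" and t: "wf_state t \<and> P (removed t) (r_of t)"
  obtain h where h: "val (move_point D l (i l t) (j l t) t) =
    t\<lparr>hull_cur := h, m_of := (m_of t)(l := i l t), n_of := (n_of t)(l := j l t)\<rparr>"
    by (rule move_point_frame)
  have ok: "hull_ok t" and "l \<in> set ls"
    using t l assms(3) by (auto simp: wf_state_def)
  from move_point_hull_ok[OF this, of "i l t" "j l t"] move_point_time[OF ok, of l "i l t" "j l t"]
  show "amortized (move_point D l (i l t) (j l t) t)
    (\<lambda>s. wf_state s \<and> P (removed s) (r_of s)) potential (potential t + 3 * H)"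
    using t by (auto simp: amortized_def h wf_state_def edges_ok_def potential_def)
next
  have "1 * real (length xs) \<le> H * length xs"
    using cost_ge_1 by (intro mult_right_mono) auto
  with b show "potential s + (\<Sum>x\<leftarrow>xs. 3 * H + 1) + 1 \<le> b"
    by (simp add: sum_list_triv algebra_simps)
qed (use assms in auto)

text \<open>A vertex reached for the first time leaves the vertex sum, and its share pays for all
  but 1 of the cost; 1 is also the cost of the other branch. The fact about \<open>e\<close> is
  carried along so that the share of the current edge is still there when
  \<open>process_edge\<close> removes it.\<close>

lemma amortized_reach_vertex:
  assumes "wf_state s" "\<not> removed s e" "v \<in> set vs"
  shows "amortized (reach_vertex D v s) (\<lambda>s. wf_state s \<and> \<not> removed s e)
    potential (potential s + 1)"
proof (cases "r_of s v = 0")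
  case False
  with assms show ?thesis by (auto simp: reach_vertex_def intro!: amortized_step)
next
  case True
  let ?loop = "foreach (S_of s v) (\<lambda>l s. move_point D l (m_of s l) (n_of s l - 1) s) s"
  have "amortized ?loop
      (\<lambda>t. wf_state t \<and> \<not> removed t e \<and> r_of t v = 0)
      potential (potential s + 4 * H * length (S_of s v) + 1)"
    using assms True
    by (intro amortized_move_points[where P = "\<lambda>rm r. \<not> rm e \<and> r v = 0"]) (auto simp: wf_state_def)
  \<comment> \<open>The released share is computed from the list after the loop, so it must still be
    the list that was traversed.\<close>
  moreover have "S_of (val (foreach xs (\<lambda>l s. move_point D l (m_of s l) (n_of s l - 1) s) t)) v
      = S_of t v" for xs and t :: "('v, 'l, 'h) state"
    by (induction xs arbitrary: t) (auto simp: move_point_def)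
  ultimately have loop: "amortized ?loop
      (\<lambda>t. wf_state t \<and> \<not> removed t e \<and> r_of t v = 0 \<and> S_of t v = S_of s v)
      potential (potential s + 4 * H * length (S_of s v) + 1)"
    by (simp add: amortized_def)
  have final: "amortized (step (t\<lparr>n_cur := n_cur t + 1, r_of := (r_of t)(v := 1)\<rparr>))
      (\<lambda>s. wf_state s \<and> \<not> removed s e) potential (potential t + - (4 * H * length (S_of s v)))"
    if t: "wf_state t \<and> \<not> removed t e \<and> r_of t v = 0 \<and> S_of t v = S_of s v"
    for t :: "('v, 'l, 'h) state"
  proof (rule amortized_step)
    let ?A = "{w \<in> set vs. r_of t w = 0}"
    have "(\<Sum>w \<in> ?A. 4 * H * length (S_of t w) + 1) =
      4 * H * length (S_of t v) + 1 + (\<Sum>w \<in> ?A - {v}. 4 * H * length (S_of t w) + 1)"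
      using t assms(3) by (intro sum.remove) auto
    moreover have "{w \<in> set vs. ((r_of t)(v := 1)) w = 0} = ?A - {v}" by auto
    ultimately show "1 + potential (t\<lparr>n_cur := n_cur t + 1, r_of := (r_of t)(v := 1)\<rparr>) \<le>
        potential t + - (4 * H * length (S_of s v))"
      using t by (simp add: potential_def)
  qed (use t in \<open>auto simp: wf_state_def hull_ok_def edges_ok_def\<close>)
  have "amortized (bind_timed ?loop (\<lambda>t. step (t\<lparr>n_cur := n_cur t + 1, r_of := (r_of t)(v := 1)\<rparr>)))
      (\<lambda>s. wf_state s \<and> \<not> removed s e) potential (potential s + 1)"
    by (rule amortized_bind[OF loop final]) auto
  with True show ?thesis by (simp add: reach_vertex_def)
qed

text \<open>Besides the moves there are five unit charges: end of the label loop, counter, two end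
  points, removal. The share of the edge covers the moves and four of these, leaving 1, as for an
  edge already removed.\<close>

lemma amortized_process_edge:
  assumes "wf_state s" "i < length es" "es ! i = (u, v, xs)"
  shows "amortized (process_edge D (i, u, v, xs) s) wf_state potential (potential s + 1)"
proof (cases "removed s i")
  case True
  with assms show ?thesis by (auto simp: process_edge_def intro!: amortized_step)
next
  case False
  have edge: "u \<in> set vs" "v \<in> set vs" "set xs \<subseteq> set ls"
    using wf_edges[of u v xs] nth_mem[OF assms(2)] assms(3) by auto
  let ?Q = "\<lambda>s :: ('v, 'l, 'h) state. wf_state s \<and> \<not> removed s i"
  have loop: "amortized (foreach xs (\<lambda>l s. move_point D l (m_of s l - 1) (n_of s l) s) s)
      ?Q potential (potential s + 4 * H * length xs + 1)"
    using assms False edge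
    by (intro amortized_move_points[where P = "\<lambda>rm r. \<not> rm i"]) auto
  have count: "amortized (step (t\<lparr>m_cur := m_cur t + 1\<rparr>)) ?Q potential (potential t + 1)"
    if "?Q t" for t
    using that
    by (intro amortized_step) (auto simp: wf_state_def hull_ok_def edges_ok_def potential_def)
  have final: "amortized (step (t\<lparr>removed := (removed t)(i := True)\<rparr>)) wf_state potential
      (potential t + - (4 * H * length xs + 3))" if t: "?Q t" for t
  proof (rule amortized_step)
    let ?A = "{k. k < length es \<and> \<not> removed t k}"
    let ?g = "\<lambda>k. 4 * H * length (snd (snd (es ! k))) + 4"
    have "sum ?g ?A = ?g i + sum ?g (?A - {i})"
      using t assms(2) by (intro sum.remove) auto
    moreover have "{k. k < length es \<and> \<not> ((removed t)(i := True)) k} = ?A - {i}" by auto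
    ultimately show "1 + potential (t\<lparr>removed := (removed t)(i := True)\<rparr>) \<le>
        potential t + - (4 * H * length xs + 3)"
      using assms(3) by (simp add: potential_def)
  qed (use t in \<open>auto simp: wf_state_def hull_ok_def edges_ok_def\<close>)
  \<comment> \<open>The bounds are assembled from the last action backwards; each preceding action
    raises the net charge by 1.\<close>
  have reach_u: "amortized (bind_timed (reach_vertex D u t)
      (\<lambda>s. step (s\<lparr>removed := (removed s)(i := True)\<rparr>)))
      wf_state potential (potential t + - (4 * H * length xs + 2))" if "?Q t" for t
    using that edge by (intro amortized_bind[OF amortized_reach_vertex final]) auto
  have reach: "amortized (bind_timed (reach_vertex D v t) (\<lambda>s. bind_timed (reach_vertex D u s)
      (\<lambda>s. step (s\<lparr>removed := (removed s)(i := True)\<rparr>))))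
      wf_state potential (potential t + - (4 * H * length xs + 1))" if "?Q t" for t
    using that edge by (intro amortized_bind[OF amortized_reach_vertex reach_u]) auto
  have rest: "amortized (bind_timed (step (t\<lparr>m_cur := m_cur t + 1\<rparr>))
      (\<lambda>s. bind_timed (reach_vertex D v s) (\<lambda>s. bind_timed (reach_vertex D u s)
      (\<lambda>s. step (s\<lparr>removed := (removed s)(i := True)\<rparr>)))))
      wf_state potential (potential t + - (4 * H * length xs))" if "?Q t" for t
    by (rule amortized_bind[OF count[OF that] reach]) auto
  show ?thesis
    unfolding process_edge_def prod.case if_not_P[OF False]
    by (rule amortized_bind[OF loop rest]) auto
qed

text \<open>\<open>2 * H\<close> pays for search and deletion. The 6 consists of reading the tree,
  updating the state, the end of the edge loop, extending the history, and 2 deposited for the new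
  history entry.\<close>

lemma amortized_select_label:
  assumes "wf_state s"
  shows "amortized (select_label D s) wf_state potential (potential s + (2 * H + 6))"
proof -
  have ok: "hull_ok s" and inv: "invar (hull_cur s)"
    using assms by (auto simp: wf_state_def hull_ok_def)
  note card = hull_ok_card[OF ok]
  define f where "f = search (m_cur s) (n_cur s) (hull_tree D (hull_cur s)) None"
  have f: "real (time f) \<le> H"
    using cost_search[OF inv card] by (simp add: f_def)
  show ?thesis
  proof (cases "val f")
    case None
    with f assms cost_ge_1 show ?thesis
      by (simp add: amortized_def select_label_def flip: f_def)
  next
    case (Some x)
    obtain i j k where x: "x = (i, j, k)" by (cases x)
    define h where "h = hull_delete D (i, j, k) (hull_cur s)"
    define s' where
      "s' = s\<lparr>hull_cur := val h, available := (available s)(k := False), A_cur := k # A_cur s\<rparr>"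
    have "(i, j, k) \<in> entries (hull_cur s)"
      using search_result[OF Some[unfolded f_def]] tree_entries[OF inv] x by auto
    then have k: "k \<in> set ls" "available s k" and ijk: "i = m_of s k" "j = n_of s k"
      using ok by (auto simp: hull_ok_def)
    have wf': "wf_state s'"
      using assms inv
      by (auto simp: wf_state_def hull_ok_def edges_ok_def s'_def h_def invar_delete
          entries_delete ijk)
    have pot': "potential s' = potential s - 2 * length (edges_of s k)"
    proof -
      let ?A = "{l \<in> set ls. available s l}"
      have "(\<Sum>l \<in> ?A. 2 * length (edges_of s l)) =
        2 * length (edges_of s k) + (\<Sum>l \<in> ?A - {k}. 2 * length (edges_of s l))"
        using k by (intro sum.remove) auto
      moreover have "{l \<in> set ls. ((available s)(k := False)) l} = ?A - {k}" by auto
      ultimately show ?thesis by (simp add: potential_def s'_def)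
    qed
    have loop: "amortized (foreach (edges_of s k) (process_edge D) s') wf_state potential
        (potential s + 1)"
    proof (rule amortized_foreach_invariant[where w = "\<lambda>_. 1"])
      fix e t assume e: "e \<in> set (edges_of s k)" and t: "wf_state t"
      obtain n u v xs where "e = (n, u, v, xs)" by (cases e)
      with e t k assms show "amortized (process_edge D e t) wf_state potential (potential t + 1)"
        by (auto simp: wf_state_def[of s] edges_ok_def intro!: amortized_process_edge)
    qed (use wf' pot' in \<open>auto simp: sum_list_triv\<close>)
    have final: "amortized (step (t\<lparr>history := (A_cur t, m_cur t, n_cur t) # history t\<rparr>))
        wf_state potential (potential t + 3)" if "wf_state t" for t
      using that
      by (intro amortized_step) (auto simp: wf_state_def hull_ok_def edges_ok_def potential_def)
    have "amortized (bind_timed (foreach (edges_of s k) (process_edge D) s')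
        (\<lambda>t. step (t\<lparr>history := (A_cur t, m_cur t, n_cur t) # history t\<rparr>)))
        wf_state potential (potential s + 4)"
      using final by (intro amortized_bind[OF loop, where d = 3]) auto
    moreover have "real (time h) \<le> H"
      using cost_delete[OF inv card] by (simp add: h_def)
    ultimately show ?thesis
      using f by (simp add: amortized_def select_label_def Some x s'_def h_def flip: f_def)
  qed
qed

lemma amortized_while_labels:
  assumes "wf_state s"
  shows "amortized (while_labels D n s) wf_state potential
    (potential s + n * (2 * H + 6) + 1)"
  using assms
proof (induction n arbitrary: s)
  case 0
  then show ?case by (auto intro: amortized_step)
next
  case (Suc n)
  show ?case
    unfolding while_labels.simps
    by (rule amortized_bind[OF amortized_select_label[OF Suc.prems],
          where d = "n * (2 * H + 6) + 1"])
      (auto intro!: amortized_mono[OF Suc.IH] simp: algebra_simps)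
qed


subsection \<open>Initialisation\<close>

definition fresh :: "('v, 'l, 'h) state \<Rightarrow> bool" where
  "fresh s \<longleftrightarrow> hull_cur s = hull_empty D \<and> history s = [([], 0, 0)]"

lemma amortized_init_vertices:
  "amortized (foreach vs init_vertex (start D :: ('v, 'l, 'h) state))
     (\<lambda>s. fresh s \<and> labels_left s = 0 \<and> edge_count s = 0 \<and> (\<forall>v \<in> set vs. S_of s v = []))
     (\<lambda>_. 0) (2 * length vs + 1)"
proof -
  \<comment> \<open>Array cells start out undefined, so the invariant speaks only of vertices
    already visited.\<close>
  define I where "I = (\<lambda>ws (s :: ('v, 'l, 'h) state).
    fresh s \<and> labels_left s = 0 \<and> edge_count s = 0 \<and> (\<forall>v \<in> set vs - set ws. S_of s v = []))"
  have "amortized (foreach vs init_vertex (start D)) (I []) (\<lambda>_. 0) (2 * length vs + 1)"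
    by (rule amortized_foreach[where w = "\<lambda>_. 1"])
      (auto simp: I_def fresh_def init_vertex_def start_def sum_list_triv intro!: amortized_step)
  then show ?thesis by (simp add: I_def)
qed

definition labels_ready :: "('v, 'l, 'h) state \<Rightarrow> bool" where
  "labels_ready s \<longleftrightarrow> fresh s \<and> labels_left s = length ls \<and> (\<forall>v \<in> set vs. S_of s v = []) \<and>
     (\<forall>l \<in> set ls. available s l)"

lemma amortized_init_labels:
  assumes "fresh s" "labels_left s = 0" "edge_count s = 0" "\<forall>v \<in> set vs. S_of s v = []"
  shows "amortized (foreach ls init_label s)
     (\<lambda>s. labels_ready s \<and> edge_count s = 0 \<and> (\<forall>l \<in> set ls. edges_of s l = []))
     (\<lambda>_. 0) (2 * length ls + 1)"
proof -
  define I where "I = (\<lambda>ks (s :: ('v, 'l, 'h) state).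
    fresh s \<and> labels_left s + length ks = length ls \<and> edge_count s = 0 \<and>
    (\<forall>v \<in> set vs. S_of s v = []) \<and>
    (\<forall>l \<in> set ls - set ks. available s l \<and> edges_of s l = []))"
  have "amortized (foreach ls init_label s) (I []) (\<lambda>_. 0) (2 * length ls + 1)"
    using assms
    by (intro amortized_foreach[where w = "\<lambda>_. 1"])
      (auto simp: I_def fresh_def init_label_def sum_list_triv intro!: amortized_step)
  then show ?thesis by (rule amortized_mono) (auto simp: I_def labels_ready_def)
qed

text \<open>
  The time that the edge lists will consume later on: \<open>8 * H + 3\<close> for each element while the hull is
  initialised, and 2 in the main loop.
\<close>

definition list_potential :: "('v, 'l, 'h) state \<Rightarrow> real" where
  "list_potential s = (\<Sum>l \<in> set ls. (8 * H + 5) * length (edges_of s l))"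

text \<open>Each pair pays for the update, the iteration and the deposit \<open>8 * H + 5\<close>.
  Each edge pays for its numbering, the end of the inner loop and the outer iteration.\<close>

lemma amortized_init_edges:
  assumes "labels_ready s" "edge_count s = 0" "\<forall>l \<in> set ls. edges_of s l = []"
  shows "amortized (foreach es init_edge s) (\<lambda>s. labels_ready s \<and> edges_ok s)
     list_potential ((8 * H + 7) * label_pairs es + 3 * length es + 1)"
proof -
  \<comment> \<open>Identifying the remaining list with \<open>drop (edge_count s) es\<close> makes
    the number given to an edge its position in \<open>es\<close>.\<close>
  define I where "I = (\<lambda>fs (s :: ('v, 'l, 'h) state).
    labels_ready s \<and> edges_ok s \<and> fs = drop (edge_count s) es)"
  have init: "amortized (init_edge (u, v, xs) t) (I fs) list_potential
      (list_potential t + ((8 * H + 7) * length xs + 2))"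
    if t: "I ((u, v, xs) # fs) t" for u v xs fs t
  proof -
    define n where "n = edge_count t"
    have drop_n: "drop n es = (u, v, xs) # fs" using t by (simp add: I_def n_def)
    then have "n < length es" by (metis drop_eq_Nil linorder_not_le list.distinct(1))
    then have n: "n < length es" "es ! n = (u, v, xs)" "fs = drop (Suc n) es"
      using drop_n by (simp_all add: Cons_nth_drop_Suc[symmetric])
    have xs: "set xs \<subseteq> set ls"
      using wf_edges[of u v xs] nth_mem[OF n(1)] n(2) by auto
    define t' where
      "t' = t\<lparr>removed := (removed t)(edge_count t := False), edge_count := edge_count t + 1\<rparr>"
    have "amortized (foreach xs (\<lambda>l s. step (s\<lparr>m_of := (m_of s)(l := m_of s l + 1),
        edges_of := (edges_of s)(l := (n, u, v, xs) # edges_of s l)\<rparr>)) t')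
        (I fs) list_potential (list_potential t + ((8 * H + 7) * length xs + 1))"
    proof (rule amortized_foreach_invariant[where w = "\<lambda>_. 8 * H + 6"])
      fix l q assume l: "l \<in> set xs" and q: "I fs q"
      let ?q = "q\<lparr>m_of := (m_of q)(l := m_of q l + 1),
        edges_of := (edges_of q)(l := (n, u, v, xs) # edges_of q l)\<rparr>"
      have "list_potential ?q = (8 * H + 5) + list_potential q"
        using l xs sum_increment_one[of "set ls" l "\<lambda>k. (8 * H + 5) * length (edges_of ?q k)"
            "\<lambda>k. (8 * H + 5) * length (edges_of q k)"]
        by (auto simp: list_potential_def algebra_simps)
      moreover have "I fs ?q"
        using q n by (auto simp: I_def labels_ready_def fresh_def edges_ok_def)
      ultimately show "amortized (step ?q) (I fs) list_potential (list_potential q + (8 * H + 6))"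
        by (intro amortized_step) auto
    next
      show "I fs t'"
        using t n by (auto simp: I_def t'_def n_def labels_ready_def fresh_def edges_ok_def)
      have "list_potential t' = list_potential t"
        by (simp add: list_potential_def t'_def)
      then show "list_potential t' + (\<Sum>x\<leftarrow>xs. 8 * H + 6 + 1) + 1 \<le>
          list_potential t + ((8 * H + 7) * length xs + 1)"
        by (simp add: sum_list_triv algebra_simps)
    qed
    then show ?thesis
      by (simp add: init_edge_def amortized_def t'_def n_def Let_def)
  qed
  have "amortized (foreach es init_edge s) (I []) list_potential
      ((8 * H + 7) * label_pairs es + 3 * length es + 1)"
  proof (rule amortized_foreach[where w = "\<lambda>(u, v, xs). (8 * H + 7) * length xs + 2"])
    have "list_potential s = 0"
      using assms by (simp add: list_potential_def)
    moreover have "(\<Sum>x\<leftarrow>fs. (case x of (u, v, xs) \<Rightarrow> (8 * H + 7) * length xs + 2) + 1) =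
        (8 * H + 7) * label_pairs fs + 3 * length fs" for fs :: "('v \<times> 'v \<times> 'l list) list"
      by (induction fs) (auto simp: label_pairs_def algebra_simps)
    ultimately show "list_potential s +
        (\<Sum>x\<leftarrow>es. (case x of (u, v, xs) \<Rightarrow> (8 * H + 7) * length xs + 2) + 1) + 1 \<le>
        (8 * H + 7) * label_pairs es + 3 * length es + 1"
      by simp
  qed (use init assms in \<open>auto simp: I_def edges_ok_def\<close>)
  then show ?thesis by (rule amortized_mono) (auto simp: I_def)
qed

text \<open>The part of the vertex sum of \<open>potential\<close> that grows while the lists
  \<open>S_of\<close> are built; \<open>potential_le\<close> adds the 1 per vertex.\<close>

definition vertex_potential :: "('v, 'l, 'h) state \<Rightarrow> real" where
  "vertex_potential s = (\<Sum>v \<in> set vs. 4 * H * length (S_of s v))"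

lemma vertex_potential_record_label:
  assumes "v \<in> set vs"
  shows "vertex_potential (val (record_label l v s)) \<le> vertex_potential s + 4 * H"
  using assms cost_ge_1 sum_increment_one[of "set vs" v
      "\<lambda>w. 4 * H * length (S_of (val (record_label l v s)) w)" "\<lambda>w. 4 * H * length (S_of s w)"]
  by (auto simp: vertex_potential_def record_label_def algebra_simps)

text \<open>An element of an edge list pays for two recordings at \<open>4 * H + 1\<close> and one
  iteration, a label for its insertion and three steps.\<close>

lemma amortized_init_points:
  fixes s :: "('v, 'l, 'h) state"
  assumes s: "labels_ready s" "edges_ok s"
  shows "amortized (foreach ls (init_point D) s)
     (\<lambda>t. wf_state t \<and> labels_left t = length ls \<and> length (history t) = 1 \<and>
       edges_of t = edges_of s)
     vertex_potential
     ((\<Sum>l \<in> set ls. (8 * H + 3) * length (edges_of s l)) + (H + 3) * length ls + 1)"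
proof -
  \<comment> \<open>Recording the current label changes only its own \<open>n_of\<close>, and labels
    still to come have no entry yet, so the coordinates of stored entries stay valid.\<close>
  define J where "J = (\<lambda>ks (t :: ('v, 'l, 'h) state).
    invar (hull_cur t) \<and>
    (\<forall>(i, j, l) \<in> entries (hull_cur t).
      l \<in> set ls - set ks \<and> i = m_of t l \<and> j = n_of t l) \<and>
    set ks \<subseteq> set ls \<and> distinct ks \<and>
    (\<forall>l \<in> set ls. available t l) \<and> edges_of t = edges_of s \<and>
    (\<forall>v \<in> set vs. set (S_of t v) \<subseteq> set ls) \<and>
    labels_left t = length ls \<and> length (history t) = 1)"
  have recorded: "amortized (record_label l v t) (J (l # ks)) vertex_potential
      (vertex_potential t + (4 * H + 1))"
    if "J (l # ks) t" "v \<in> set vs" for l ks t v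
  proof -
    have "J (l # ks) (val (record_label l v t))"
      using that by (auto simp: J_def record_label_def)
    moreover have "time (record_label l v t) = 1"
      by (simp add: record_label_def)
    ultimately show ?thesis
      using vertex_potential_record_label[OF that(2), of l t] by (simp add: amortized_def)
  qed
  have point: "amortized (init_point D l t) (J ks) vertex_potential
      (vertex_potential t + ((8 * H + 3) * length (edges_of s l) + (H + 2)))"
    if t: "J (l # ks) t" for l ks t
  proof -
    have l: "l \<in> set ls" and edges: "edges_of t = edges_of s"
      using t by (auto simp: J_def)
    have loop: "amortized (foreach (edges_of s l)
       (\<lambda>(_, u, v, _) s. bind_timed (record_label l u s) (\<lambda>s. record_label l v s)) t)
       (J (l # ks)) vertex_potential
       (vertex_potential t + (8 * H + 3) * length (edges_of s l) + 1)"
    proof (rule amortized_foreach_invariant[where w = "\<lambda>_. 8 * H + 2"])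
      fix e q assume e: "e \<in> set (edges_of s l)" and q: "J (l # ks) q"
      obtain n u v xs where e_def: "e = (n, u, v, xs)" by (cases e)
      then have "n < length es" "es ! n = (u, v, xs)"
        using e l s(2) by (auto simp: edges_ok_def)
      then have uv: "u \<in> set vs" "v \<in> set vs"
        using wf_edges[of u v xs] nth_mem[of n es] by auto
      show "amortized ((\<lambda>(_, u, v, _) s. bind_timed (record_label l u s) (\<lambda>s. record_label l v s)) e q)
          (J (l # ks)) vertex_potential (vertex_potential q + (8 * H + 2))"
        unfolding e_def prod.case
        by (rule amortized_bind[OF recorded[OF q uv(1)], where d = "4 * H + 1"])
          (use uv in \<open>auto intro: recorded\<close>)
    qed (use t in \<open>auto simp: sum_list_triv algebra_simps\<close>)
    have insert: "amortized (bind_timed (hull_insert D (m_of q l, n_of q l, l) (hull_cur q))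
        (\<lambda>h. step (q\<lparr>hull_cur := h\<rparr>))) (J ks) vertex_potential (vertex_potential q + (H + 1))"
      if q: "J (l # ks) q" for q
    proof -
      have inv: "invar (hull_cur q)" using q by (simp add: J_def)
      have "card (entries (hull_cur q)) \<le> length ls"
        using q by (intro card_entries_le[of _ "m_of q" "n_of q"]) (auto simp: J_def)
      with cost_insert[OF inv] q inv show ?thesis
        by (auto simp: amortized_def J_def invar_insert entries_insert vertex_potential_def)
    qed
    show ?thesis
      unfolding init_point_def edges
      by (rule amortized_bind[OF loop insert]) auto
  qed
  have "amortized (foreach ls (init_point D) s) (J []) vertex_potential
     ((\<Sum>l \<in> set ls. (8 * H + 3) * length (edges_of s l)) + (H + 3) * length ls + 1)"
  proof (rule amortized_foreach[OF point])
    show "J ls s"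
      using s invar_empty distinct_labels
      by (auto simp: J_def labels_ready_def fresh_def)
    have "vertex_potential s = 0"
      using s by (simp add: vertex_potential_def labels_ready_def)
    then show "vertex_potential s +
        (\<Sum>l\<leftarrow>ls. (8 * H + 3) * length (edges_of s l) + (H + 2) + 1) + 1 \<le>
        (\<Sum>l \<in> set ls. (8 * H + 3) * length (edges_of s l)) + (H + 3) * length ls + 1"
      using distinct_labels
      by (simp add: sum_list_distinct_conv_sum_set sum.distrib distinct_card algebra_simps)
  qed
  then show ?thesis
    using s(2)
    by (elim amortized_mono) (auto simp: J_def wf_state_def hull_ok_def edges_ok_def)
qed

section \<open>Total running time in terms of \<open>H\<close>\<close>

lemma potential_le:
  assumes "length (history s) = 1"
  shows "potential s \<le> 4 * H * label_pairs es + 4 * length es + vertex_potential s + length vs +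
    (\<Sum>l \<in> set ls. 2 * length (edges_of s l)) + 2"
proof -
  let ?g = "\<lambda>e. 4 * H * length (snd (snd e)) + 4 :: real"
  have "(\<Sum>i \<in> {i. i < length es \<and> \<not> removed s i}. ?g (es ! i)) \<le> (\<Sum>i<length es. ?g (es ! i))"
    using cost_ge_1 by (intro sum_mono2) auto
  also have "\<dots> = (\<Sum>e\<leftarrow>es. ?g e)"
    by (simp add: sum_list_sum_nth atLeast0LessThan)
  also have "\<dots> = 4 * H * label_pairs es + 4 * length es"
    by (induction es) (auto simp: label_pairs_def algebra_simps)
  finally have edges: "(\<Sum>i \<in> {i. i < length es \<and> \<not> removed s i}. ?g (es ! i)) \<le>
    4 * H * label_pairs es + 4 * length es" .
  have "(\<Sum>v \<in> {v \<in> set vs. r_of s v = 0}. 4 * H * length (S_of s v) + 1) \<le>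
      (\<Sum>v \<in> set vs. 4 * H * length (S_of s v) + 1)"
    using cost_ge_1 by (intro sum_mono2) auto
  also have "\<dots> = vertex_potential s + length vs"
    using distinct_vertices by (simp add: vertex_potential_def sum.distrib distinct_card)
  finally have vertices: "(\<Sum>v \<in> {v \<in> set vs. r_of s v = 0}. 4 * H * length (S_of s v) + 1) \<le>
    vertex_potential s + length vs" .
  have "(\<Sum>l \<in> {l \<in> set ls. available s l}. 2 * length (edges_of s l)) \<le>
      (\<Sum>l \<in> set ls. 2 * length (edges_of s l))"
    by (intro sum_mono2) auto
  then have "real (\<Sum>l \<in> {l \<in> set ls. available s l}. 2 * length (edges_of s l)) \<le>
      real (\<Sum>l \<in> set ls. 2 * length (edges_of s l))"
    by (rule of_nat_mono)
  with edges vertices assms show ?thesis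
    by (simp add: potential_def)
qed

text \<open>A pair pays \<open>8 * H + 7\<close> while the edge lists are built and
  \<open>4 * H\<close> when its edge is removed. A label pays 2, \<open>H + 3\<close> and
  \<open>2 * H + 6\<close> in the three loops over labels.\<close>

lemma time_greedy_or:
  "real (time (greedy_or D vs ls es)) \<le>
     (12 * H + 7) * label_pairs es + 7 * length es + 3 * length vs + (3 * H + 11) * length ls + 10"
proof -
  define s\<^sub>1 where "s\<^sub>1 = foreach vs init_vertex (start D :: ('v, 'l, 'h) state)"
  define s\<^sub>2 where "s\<^sub>2 = foreach ls init_label (val s\<^sub>1)"
  define s\<^sub>3 where "s\<^sub>3 = foreach es init_edge (val s\<^sub>2)"
  define s\<^sub>4 where "s\<^sub>4 = foreach ls (init_point D) (val s\<^sub>3)"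
  define s\<^sub>5 where "s\<^sub>5 = while_labels D (labels_left (val s\<^sub>4)) (val s\<^sub>4)"
  define best where "best = foreach (history (val s\<^sub>5))
    (\<lambda>c best. if density best < density c then step c else step best) ([], 0, 0)"
  have 1: "amortized s\<^sub>1 (\<lambda>s. fresh s \<and> labels_left s = 0 \<and> edge_count s = 0 \<and>
      (\<forall>v \<in> set vs. S_of s v = [])) (\<lambda>_. 0) (2 * length vs + 1)"
    unfolding s\<^sub>1_def by (rule amortized_init_vertices)
  then have 2: "amortized s\<^sub>2 (\<lambda>s. labels_ready s \<and> edge_count s = 0 \<and>
      (\<forall>l \<in> set ls. edges_of s l = [])) (\<lambda>_. 0) (2 * length ls + 1)"
    unfolding s\<^sub>2_def by (intro amortized_init_labels) (auto simp: amortized_def)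
  then have 3: "amortized s\<^sub>3 (\<lambda>s. labels_ready s \<and> edges_ok s) list_potential
      ((8 * H + 7) * label_pairs es + 3 * length es + 1)"
    unfolding s\<^sub>3_def by (intro amortized_init_edges) (auto simp: amortized_def)
  then have 4: "amortized s\<^sub>4 (\<lambda>t. wf_state t \<and> labels_left t = length ls \<and>
       length (history t) = 1 \<and> edges_of t = edges_of (val s\<^sub>3)) vertex_potential
     ((\<Sum>l \<in> set ls. (8 * H + 3) * length (edges_of (val s\<^sub>3) l)) + (H + 3) * length ls + 1)"
    unfolding s\<^sub>4_def by (intro amortized_init_points) (auto simp: amortized_def)
  then have 5: "amortized s\<^sub>5 wf_state potential
      (potential (val s\<^sub>4) + length ls * (2 * H + 6) + 1)"
    unfolding s\<^sub>5_def using amortized_while_labels[of "val s\<^sub>4" "length ls"]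
    by (simp add: amortized_def)
  have best: "amortized best (\<lambda>_. True) (\<lambda>_. 0) (2 * length (history (val s\<^sub>5)) + 1)"
    unfolding best_def
    by (rule amortized_foreach_invariant[where w = "\<lambda>_. 1"])
      (auto simp: sum_list_triv intro!: amortized_step)
  \<comment> \<open>The potential left after the main loop pays for the final scan of the
    history.\<close>
  have history: "2 * length (history (val s\<^sub>5)) \<le> potential (val s\<^sub>5)"
    using cost_ge_1 unfolding potential_def by (auto intro!: add_nonneg_nonneg sum_nonneg)
  have pot: "potential (val s\<^sub>4) \<le> 4 * H * label_pairs es + 4 * length es +
      vertex_potential (val s\<^sub>4) + length vs +
      (\<Sum>l \<in> set ls. 2 * length (edges_of (val s\<^sub>3) l)) + 2"
    using potential_le[of "val s\<^sub>4"] 4 by (auto simp: amortized_def)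
  \<comment> \<open>The deposit splits into the share spent by \<open>init_point\<close> and the
    share spent by the main loop.\<close>
  have lists: "list_potential (val s\<^sub>3) =
      (\<Sum>l \<in> set ls. (8 * H + 3) * length (edges_of (val s\<^sub>3) l)) +
      (\<Sum>l \<in> set ls. 2 * length (edges_of (val s\<^sub>3) l))"
    by (simp add: list_potential_def algebra_simps flip: sum.distrib)
  have "time (greedy_or D vs ls es) =
      1 + time s\<^sub>1 + time s\<^sub>2 + time s\<^sub>3 + time s\<^sub>4 + time s\<^sub>5 + time best + 1"
    by (simp add: greedy_or_def best_def s\<^sub>5_def s\<^sub>4_def s\<^sub>3_def s\<^sub>2_def s\<^sub>1_def)
  with 1 2 3 4 5 best history pot lists show ?thesis
    unfolding amortized_def by (auto simp: algebra_simps)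
qed

end


section \<open>Encodings\<close>

lemma encodes_card_vertices: "encodes vs ls es V E lab L \<Longrightarrow> length vs = card V"
  and encodes_card_labels: "encodes vs ls es V E lab L \<Longrightarrow> length ls = card L"
  by (auto simp: encodes_def distinct_card)

lemma encodes_card_edges:
  assumes "encodes vs ls es V E lab L"
  shows "length es = card E"
  using assms distinct_card[of "map (\<lambda>(u, v, xs). {u, v}) es"] by (auto simp: encodes_def)

text \<open>Distinctness of the edges and of each label list ensures that counting along the
  encoding counts no pair twice.\<close>

lemma encodes_card_pairs:
  assumes "encodes vs ls es V E lab L"
  shows "card {(e, k). e \<in> E \<and> k \<in> lab e} = label_pairs es"
proof -
  let ?f = "\<lambda>(u, v, xs). {u, v}"
  have dist: "distinct (map ?f es)" and E: "?f ` set es = E"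
    and labs: "\<And>u v xs. (u, v, xs) \<in> set es \<Longrightarrow> distinct xs \<and> set xs = lab {u, v}"
    using assms by (auto simp: encodes_def)
  have fin: "finite E" "\<And>e. e \<in> E \<Longrightarrow> finite (lab e)"
    unfolding E[symmetric] using labs by (auto, metis List.finite_set)
  have "{(e, k). e \<in> E \<and> k \<in> lab e} = Sigma E lab" by auto
  then have "card {(e, k). e \<in> E \<and> k \<in> lab e} = (\<Sum>e \<in> E. card (lab e))"
    using fin by simp
  also have "\<dots> = (\<Sum>e\<leftarrow>map ?f es. card (lab e))"
    using dist E by (simp add: sum_list_distinct_conv_sum_set del: map_map)
  also have "\<dots> = label_pairs es"
    unfolding label_pairs_def map_map
    by (intro arg_cong[where f = sum_list] map_cong) (auto dest!: labs simp flip: distinct_card)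
  finally show ?thesis .
qed

section \<open>The asymptotic bound\<close>

lemma log_offset_le:
  assumes "2 \<le> n"
  shows "(log 2 (real (n + 2)))\<^sup>2 \<le> 4 * (log 2 (real n))\<^sup>2"
proof -
  \<comment> \<open>For n \<ge> 2, n + 2 is at most n^2, so the offset at most doubles the
    logarithm.\<close>
  have "n + 2 \<le> n * 2" using assms by simp
  also have "\<dots> \<le> n\<^sup>2" using assms by (simp add: power2_eq_square)
  finally have "real (n + 2) \<le> (real n)\<^sup>2" by (metis of_nat_le_iff of_nat_power)
  then have "log 2 (real (n + 2)) \<le> log 2 ((real n)\<^sup>2)"
    using assms by (intro log_mono) auto
  also have "\<dots> = 2 * log 2 (real n)" using assms by (simp add: log_nat_power)
  finally have "(log 2 (real (n + 2)))\<^sup>2 \<le> (2 * log 2 (real n))\<^sup>2"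
    by (intro power_mono) auto
  then show ?thesis by (simp add: power_mult_distrib)
qed

text \<open>As every label occurs on an edge, \<open>card L\<close> is at most p and the cost per
  label can be charged to pairs; a nonempty vertex set absorbs the additive constant.\<close>

theorem theorem5:
  fixes D :: "('l, 'h) hull_structure"
  assumes "dynamic_hull D"
  shows "\<exists>C. \<forall>(V :: 'v set) (E :: 'v set set) (lab :: 'v set \<Rightarrow> 'l set) (L :: 'l set) vs ls es.
           edge_labeled_graph V E lab L \<longrightarrow> V \<noteq> {} \<longrightarrow> (\<forall>l \<in> L. \<exists>e \<in> E. l \<in> lab e) \<longrightarrow>
           encodes vs ls es V E lab L \<longrightarrow>
           real (time (greedy_or D vs ls es)) \<le>
             C * (real (card {(e, k). e \<in> E \<and> k \<in> lab e}) * (log 2 (real (card L)))\<^sup>2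
                  + real (card V) + real (card E))"
proof -
  obtain invar entries c where c: "0 \<le> c"
    and cost: "\<And>N. hull_cost D invar entries N (c * (log 2 (real (N + 2)))\<^sup>2)"
    by (rule dynamic_hull_cost[OF assms], rule that)
  \<comment> \<open>33 = 12 + 7 + 3 + 11 collects the terms in p, using 1 \<le> \<open>H\<close>;
    the 4 is the price of dropping the offset in the logarithm; 13 = 3 + 10 is the coefficient of
    \<open>card V\<close> and dominates the 7 of \<open>card E\<close>.\<close>
  define C where "C = 33 * (4 * c) + 13"
  show ?thesis
  proof (intro exI[of _ C] allI impI)
    fix V :: "'v set" and E and lab :: "'v set \<Rightarrow> 'l set" and L vs ls es
    assume G: "edge_labeled_graph V E lab L" and V: "V \<noteq> {}"
      and used: "\<forall>l \<in> L. \<exists>e \<in> E. l \<in> lab e" and enc: "encodes vs ls es V E lab L"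
    define H where "H = c * (log 2 (real (card L + 2)))\<^sup>2"
    define p where "p = card {(e, k). e \<in> E \<and> k \<in> lab e}"
    define g where "g = (log 2 (real (card L)))\<^sup>2"
    interpret G: edge_labeled_graph V E lab L by fact
    have len: "length vs = card V" "length ls = card L" "length es = card E"
      "label_pairs es = p"
      using encodes_card_vertices[OF enc] encodes_card_labels[OF enc] encodes_card_edges[OF enc]
        encodes_card_pairs[OF enc] by (simp_all add: p_def)
    have H: "hull_cost D invar entries (length ls) H"
      using cost[of "card L"] by (simp add: H_def len)
    have edge: "u \<in> set vs \<and> v \<in> set vs \<and> set xs \<subseteq> set ls" if "(u, v, xs) \<in> set es" for u v xs
    proof -
      have "{u, v} \<in> E"
        using enc imageI[OF that, of "\<lambda>(u, v, xs). {u, v}"] by (simp add: encodes_def)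
      moreover have "set xs = lab {u, v}" "set vs = V" "set ls = L"
        using enc that by (auto simp: encodes_def)
      ultimately show ?thesis
        using subsetD[OF G.edges, of "{u, v}"] G.labels[of "{u, v}"]
        by (auto simp: doubleton_eq_iff)
    qed
    interpret greedy_run D invar entries H ls vs es
      using enc by (intro greedy_run.intro greedy_run_axioms.intro H edge) (auto simp: encodes_def)
    have fin: "finite E"
      by (rule finite_subset[of _ "Pow V"]) (use G.edges G.finite_vertices in auto)
    have sub: "{(e, k). e \<in> E \<and> k \<in> lab e} \<subseteq> E \<times> L"
      using G.labels by auto
    have fin_pairs: "finite {(e, k). e \<in> E \<and> k \<in> lab e}"
      using finite_subset[OF sub] fin G.finite_labels by simp
    have "L \<subseteq> snd ` {(e, k). e \<in> E \<and> k \<in> lab e}"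
      using used by force
    then have Lp: "card L \<le> p"
      unfolding p_def using fin_pairs by (meson surj_card_le)
    have pE: "p \<le> card E * card L"
      unfolding p_def using card_mono[OF _ sub] fin G.finite_labels by (simp add: card_cartesian_product)
    have "1 \<le> card V"
      using V G.finite_vertices by (simp add: Suc_le_eq card_gt_0_iff)
    have "real (time (greedy_or D vs ls es)) \<le>
        (12 * H + 7) * p + 7 * card E + 3 * card V + (3 * H + 11) * card L + 10"
      using time_greedy_or by (simp add: len)
    also have "\<dots> \<le> (12 * H + 7) * p + 7 * card E + 3 * card V + (3 * H + 11) * p + 10 * card V"
      using Lp \<open>1 \<le> card V\<close> cost_ge_1 by (intro add_mono mult_left_mono) auto
    also have "\<dots> \<le> 33 * (H * p) + 7 * card E + 13 * card V"
      using mult_right_mono[OF cost_ge_1, of p] by (simp add: algebra_simps)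
    also have "33 * (H * p) \<le> 33 * (4 * c * (p * g + card E))"
    proof -
      have "(log 2 (real (card L + 2)))\<^sup>2 * p \<le> 4 * (p * g + card E)"
      proof (cases "2 \<le> card L")
        case True
        have "(log 2 (real (card L + 2)))\<^sup>2 * p \<le> (4 * g) * p"
          using log_offset_le[OF True] by (intro mult_right_mono) (auto simp: g_def)
        then show ?thesis by (simp add: algebra_simps)
      next
        case False
        \<comment> \<open>With at most one label there are no more pairs than edges, so the edge
          term bears the whole cost; the offset logarithm is at most \<open>log 2 4\<close>.\<close>
        then have "p \<le> card E"
          using pE order_trans[OF pE mult_left_mono[of "card L" 1 "card E"]] by simp
        have "log 2 (real (card L + 2)) \<le> log 2 4"
          using False by (intro log_mono) auto
        also have "log 2 4 = (2 :: real)" using log_pow_cancel[of "2 :: real" 2] by simp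
        finally have "(log 2 (real (card L + 2)))\<^sup>2 \<le> 2\<^sup>2"
          by (intro power_mono) auto
        then have "(log 2 (real (card L + 2)))\<^sup>2 * real p \<le> 2\<^sup>2 * real (card E)"
          using \<open>p \<le> card E\<close> by (intro mult_mono) auto
        moreover have "0 \<le> p * g" by (simp add: g_def)
        ultimately show ?thesis by (simp add: algebra_simps)
      qed
      then have "c * ((log 2 (real (card L + 2)))\<^sup>2 * p) \<le> c * (4 * (p * g + card E))"
        using c by (rule mult_left_mono)
      then show ?thesis by (simp add: H_def algebra_simps)
    qed
    also have "33 * (4 * c * (p * g + card E)) + 7 * card E + 13 * card V \<le>
        C * (p * g + card V + card E)"
    proof -
      have "0 \<le> p * g" "0 \<le> c * card V" using c by (auto simp: g_def)
      then show ?thesis by (simp add: C_def algebra_simps)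
    qed
    finally show "real (time (greedy_or D vs ls es)) \<le>
        C * (real (card {(e, k). e \<in> E \<and> k \<in> lab e}) * (log 2 (real (card L)))\<^sup>2
          + real (card V) + real (card E))"
      by (simp add: p_def g_def)
  qed
qed

end
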